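(* Let $\Omega$ be a compact Hausdorff space and let $H$ be a complex Hilbert space. Then every weak-2-local derivation $\Delta: C(\Omega,K(H))\to C(\Omega,K(H))$ is a (linear) derivation.
   Context: $K(H)$ is the C$^*$-algebra of all compact linear operators on $H$. $C(\Omega,K(H))$ denotes the C$^*$-algebra of all norm-continuous functions $\Omega\to K(H)$ with pointwise operations and the sup norm. A derivation on a C$^*$-algebra $B$ is a linear map $D:B\to B$ with $D(ab)=D(a)b+aD(b)$ for all $a,b\in B$. A weak-2-local derivation on $B$ is a mapping $\Delta:B\to B$ (not assumed linear or continuous) such that for all $a,b\in B$ and every $\phi\in B^*$ there exists a derivation $D_{a,b,\phi}:B\to B$, depending on $a$, $b$ and $\phi$, with $\phi(\Delta(a))=\phi(D_{a,b,\phi}(a))$ and $\phi(\Delta(b))=\phi(D_{a,b,\phi}(b))$. *)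

theory Defs
  imports "HOL-Analysis.Analysis"
begin

class complex_vector = real_vector +
  fixes scaleC :: "complex \<Rightarrow> 'a \<Rightarrow> 'a"  (infixr \<open>*\<^sub>C\<close> 75)
  assumes scaleC_add_right: "c *\<^sub>C (x + y) = c *\<^sub>C x + c *\<^sub>C y"
    and scaleC_add_left: "(c + d) *\<^sub>C x = c *\<^sub>C x + d *\<^sub>C x"
    and scaleC_scaleC: "c *\<^sub>C d *\<^sub>C x = (c * d) *\<^sub>C x"
    and scaleC_of_real: "complex_of_real r *\<^sub>C x = r *\<^sub>R x"

text \<open>The inner product is linear in its first argument. The class
  \<^class>\<open>real_normed_vector\<close> only supplies the name of the norm and of the metric topology;
  the last axiom makes the norm the one induced by the inner product.\<close>

class complex_inner = complex_vector + real_normed_vector +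
  fixes cinner :: "'a \<Rightarrow> 'a \<Rightarrow> complex"
  assumes cinner_add_left: "cinner (x + y) z = cinner x z + cinner y z"
    and cinner_scaleC_left: "cinner (c *\<^sub>C x) y = c * cinner x y"
    and cinner_commute: "cinner x y = cnj (cinner y x)"
    and cinner_self: "cinner x x = complex_of_real ((norm x)\<^sup>2)"

class complex_hilbert_space = complex_inner + complete_space

lemma norm_scaleC: "norm (c *\<^sub>C x) = cmod c * norm x" for x :: "'a::complex_inner"
proof -
  have "cinner (c *\<^sub>C x) (c *\<^sub>C x) = c * cnj (c * cinner x x)"
    by (metis cinner_commute cinner_scaleC_left)
  also have "\<dots> = (c * cnj c) * complex_of_real ((norm x)\<^sup>2)"
    by (simp add: cinner_self)
  also have "\<dots> = complex_of_real ((cmod c * norm x)\<^sup>2)"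
    by (simp add: complex_norm_square[symmetric] power_mult_distrib)
  finally have "(norm (c *\<^sub>C x))\<^sup>2 = (cmod c * norm x)\<^sup>2"
    unfolding cinner_self using of_real_eq_iff by blast
  then show ?thesis
    by (simp add: power2_eq_iff_nonneg)
qed

instantiation blinfun :: (real_normed_vector, complex_inner) complex_vector
begin

lift_definition scaleC_blinfun :: "complex \<Rightarrow> 'a \<Rightarrow>\<^sub>L 'b \<Rightarrow> 'a \<Rightarrow>\<^sub>L 'b"
  is "\<lambda>c T x. c *\<^sub>C T x"
proof -
  fix c :: complex and T :: "'a \<Rightarrow> 'b"
  assume T: "bounded_linear T"
  have "bounded_linear (\<lambda>y::'b. c *\<^sub>C y)"
  proof (rule bounded_linear_intro[where K = "cmod c"])
    show "c *\<^sub>C r *\<^sub>R y = r *\<^sub>R c *\<^sub>C y" for r and y :: 'b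
      by (simp add: scaleC_of_real[symmetric] scaleC_scaleC mult.commute)
  qed (simp_all add: scaleC_add_right norm_scaleC mult.commute)
  then show "bounded_linear (\<lambda>x. c *\<^sub>C T x)"
    using T by (rule bounded_linear_compose)
qed

instance
  by standard
    (transfer; simp add: fun_eq_iff scaleC_add_right scaleC_add_left scaleC_scaleC scaleC_of_real)+

end

text \<open>\<open>'h \<Rightarrow>\<^sub>L 'h\<close> consists of the bounded real-linear maps, so complex homogeneity is
  demanded explicitly; boundedness loses nothing, as compact operators are bounded.\<close>

definition compact_operator :: "('h::complex_hilbert_space \<Rightarrow>\<^sub>L 'h) \<Rightarrow> bool" where
  "compact_operator T \<longleftrightarrow>
     (\<forall>c x. blinfun_apply T (c *\<^sub>C x) = c *\<^sub>C blinfun_apply T x) \<and>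
     (\<forall>S. bounded S \<longrightarrow> compact (closure (blinfun_apply T ` S)))"

text \<open>The algebra \<open>C(\<Omega>, K(H))\<close>, for \<open>\<Omega>\<close> the topology \<open>X\<close>. Functions on
  \<^term>\<open>topspace X\<close> are represented by their extension by \<open>0\<close> to the whole type, so that
  equality is equality on \<^term>\<open>topspace X\<close> and the algebra operations are pointwise.\<close>

definition C_K :: "'a topology \<Rightarrow> ('a \<Rightarrow> 'h::complex_hilbert_space \<Rightarrow>\<^sub>L 'h) set" where
  "C_K X = {f. continuous_map X euclidean f \<and>
               (\<forall>t\<in>topspace X. compact_operator (f t)) \<and>
               (\<forall>t. t \<notin> topspace X \<longrightarrow> f t = 0)}"

text \<open>Taking the supremum over the whole type adds at most the value \<open>0\<close>, which also gives
  the right norm when \<^term>\<open>topspace X\<close> is empty.\<close>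

definition sup_norm :: "('a \<Rightarrow> 'h::complex_hilbert_space \<Rightarrow>\<^sub>L 'h) \<Rightarrow> real" where
  "sup_norm f = (SUP t. norm (f t))"

definition derivation ::
  "'a topology \<Rightarrow> (('a \<Rightarrow> 'h::complex_hilbert_space \<Rightarrow>\<^sub>L 'h) \<Rightarrow> ('a \<Rightarrow> 'h \<Rightarrow>\<^sub>L 'h)) \<Rightarrow> bool" where
  "derivation X D \<longleftrightarrow>
     D \<in> C_K X \<rightarrow> C_K X \<and>
     (\<forall>a\<in>C_K X. \<forall>b\<in>C_K X. D (\<lambda>t. a t + b t) = (\<lambda>t. D a t + D b t)) \<and>
     (\<forall>c. \<forall>a\<in>C_K X. D (\<lambda>t. c *\<^sub>C a t) = (\<lambda>t. c *\<^sub>C D a t)) \<and>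
     (\<forall>a\<in>C_K X. \<forall>b\<in>C_K X.
        D (\<lambda>t. a t o\<^sub>L b t) = (\<lambda>t. (D a t o\<^sub>L b t) + (a t o\<^sub>L D b t)))"

definition dual_C_K ::
  "'a topology \<Rightarrow> (('a \<Rightarrow> 'h::complex_hilbert_space \<Rightarrow>\<^sub>L 'h) \<Rightarrow> complex) set" where
  "dual_C_K X = {\<phi>.
     (\<forall>a\<in>C_K X. \<forall>b\<in>C_K X. \<phi> (\<lambda>t. a t + b t) = \<phi> a + \<phi> b) \<and>
     (\<forall>c. \<forall>a\<in>C_K X. \<phi> (\<lambda>t. c *\<^sub>C a t) = c * \<phi> a) \<and>
     (\<exists>K. \<forall>a\<in>C_K X. cmod (\<phi> a) \<le> K * sup_norm a)}"

definition weak_2_local_derivation ::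
  "'a topology \<Rightarrow> (('a \<Rightarrow> 'h::complex_hilbert_space \<Rightarrow>\<^sub>L 'h) \<Rightarrow> ('a \<Rightarrow> 'h \<Rightarrow>\<^sub>L 'h)) \<Rightarrow> bool" where
  "weak_2_local_derivation X \<Delta> \<longleftrightarrow>
     \<Delta> \<in> C_K X \<rightarrow> C_K X \<and>
     (\<forall>a\<in>C_K X. \<forall>b\<in>C_K X. \<forall>\<phi>\<in>dual_C_K X.
        \<exists>D. derivation X D \<and> \<phi> (\<Delta> a) = \<phi> (D a) \<and> \<phi> (\<Delta> b) = \<phi> (D b))"

end

theory Submission
  imports Defs
begin

text \<open>If a compact operator \<open>c\<close> satisfies \<open>c x = l x\<close> and \<open>g \<circ> c = l g\<close> for a vector \<open>x\<close> and a bounded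
  functional \<open>g\<close>, then \<open>g((D c) x) = 0\<close> for every derivation \<open>D\<close>. Applied pointwise to differences \<open>a - b\<close>,
  this shows that \<open>(\<Delta> a)(t) = F (a t)\<close> for a homogeneous map \<open>F\<close> on the compact operators such that
  \<open>g((F A) x)\<close> depends only on \<open>A x\<close> and \<open>g \<circ> A\<close>, and moreover only modulo simultaneous
  multiples of \<open>x\<close> and \<open>g\<close>. Because \<open>F A\<close> is itself linear, interpolating between two operators along a
  second vector (or functional) makes \<open>g((F A) x)\<close> affine in \<open>A x\<close> and in \<open>g \<circ> A\<close> separately, and homogeneity
  removes the mixed term: \<open>F\<close> is additive. Finally, a bilinear form in \<open>(f, x)\<close> that vanishes whenever
  \<open>f x = 0\<close> is a multiple of \<open>f x\<close>; applied to \<open>g((F (u \<otimes> f)) x)\<close> this exhibits \<open>F\<close> as a commutator,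
  hence as a derivation.\<close>

subsection \<open>Bounded complex-linear functionals\<close>

lemma scaleC_zero_left [simp]: "0 *\<^sub>C x = 0"
  using scaleC_of_real[of 0 x] by simp

lemma scaleC_zero_right [simp]: "c *\<^sub>C 0 = 0"
  using scaleC_add_right[of c 0 0] by simp

lemma scaleC_one [simp]: "1 *\<^sub>C x = x"
  using scaleC_of_real[of 1 x] by simp

lemma scaleC_minus_right [simp]: "c *\<^sub>C (- x) = - (c *\<^sub>C x)"
  using scaleC_add_right[of c x "- x"] by (simp add: eq_neg_iff_add_eq_0 add.commute)

lemma scaleC_minus_left: "(- c) *\<^sub>C x = - (c *\<^sub>C x)"
  using scaleC_add_left[of c "- c" x] by (simp add: eq_neg_iff_add_eq_0 add.commute)

lemma scaleC_diff_right: "c *\<^sub>C (x - y) = c *\<^sub>C x - c *\<^sub>C y"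
  using scaleC_add_right[of c x "- y"] by simp

lemma scaleC_left_commute: "c *\<^sub>C d *\<^sub>C x = d *\<^sub>C c *\<^sub>C x"
  by (simp add: scaleC_scaleC mult.commute)

lemma scaleC_scaleR_commute: "c *\<^sub>C r *\<^sub>R x = r *\<^sub>R c *\<^sub>C x"
  by (simp add: scaleC_of_real[symmetric] scaleC_left_commute)

lemma scaleC_two: "2 *\<^sub>C x = x + x"
  using scaleC_add_left[of 1 1 x] by simp

lemma cinner_scaleC_right: "cinner x (c *\<^sub>C y) = cnj c * cinner x y"
  by (metis cinner_commute cinner_scaleC_left complex_cnj_mult)

lemma cinner_add_right: "cinner x (y + z) = cinner x y + cinner x z"
  by (metis cinner_commute cinner_add_left complex_cnj_add)

lemma cinner_zero_left [simp]: "cinner 0 y = 0"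
  using cinner_add_left[of 0 0 y] by simp

lemma cinner_diff_left: "cinner (x - y) z = cinner x z - cinner y z"
  using cinner_add_left[of "x - y" y z] by simp

lemma cinner_Cauchy_Schwarz: "cmod (cinner x y) \<le> norm x * norm y"
proof (cases "y = 0")
  case True
  have "cinner x 0 = 0"
    by (subst cinner_commute) simp
  then show ?thesis using True by simp
next
  case False
  define N where "N = complex_of_real ((norm y)\<^sup>2)"
  define c where "c = cinner x y"
  \<comment> \<open>Component of \<open>x\<close> orthogonal to \<open>y\<close>, multiplied by
    \<open>N\<close> so that no division occurs.\<close>
  define z where "z = N *\<^sub>C x - c *\<^sub>C y"
  have zy: "cinner z y = 0"
    by (simp add: z_def cinner_diff_left cinner_scaleC_left cinner_self N_def c_def)
  have "cinner z z = cinner z (N *\<^sub>C x + (- c) *\<^sub>C y)"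
    by (simp add: z_def scaleC_minus_left)
  also have "\<dots> = N * cinner z x"
    by (simp add: cinner_add_right cinner_scaleC_right zy) (simp add: N_def)
  also have "cinner z x = N * cinner x x - c * cnj c"
    by (simp add: z_def cinner_diff_left cinner_scaleC_left c_def cinner_commute[of y x])
  also have "N * (N * cinner x x - c * cnj c)
      = complex_of_real ((norm y)\<^sup>2 * ((norm y)\<^sup>2 * (norm x)\<^sup>2 - (cmod c)\<^sup>2))"
    by (simp add: N_def cinner_self complex_norm_square[symmetric])
  finally have "(norm z)\<^sup>2 = (norm y)\<^sup>2 * ((norm y)\<^sup>2 * (norm x)\<^sup>2 - (cmod c)\<^sup>2)"
    unfolding cinner_self using of_real_eq_iff by blast
  then have "0 \<le> (norm y)\<^sup>2 * ((norm y)\<^sup>2 * (norm x)\<^sup>2 - (cmod c)\<^sup>2)"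
    by (metis zero_le_power2)
  then have "(cmod c)\<^sup>2 \<le> (norm x * norm y)\<^sup>2"
    using False by (simp add: zero_le_mult_iff power_mult_distrib mult.commute)
  then show ?thesis
    unfolding c_def by (rule power2_le_imp_le) simp
qed

text \<open>The continuous dual of \<open>H\<close>, kept as plain functions: the type of bounded
  linear maps gives only real linearity, and \<open>\<lambda>w. g (A w)\<close> is again a
  functional without coercions.\<close>

definition cfunctional :: "('h::complex_inner \<Rightarrow> complex) \<Rightarrow> bool" where
  "cfunctional g \<longleftrightarrow> (\<forall>x y. g (x + y) = g x + g y) \<and> (\<forall>c x. g (c *\<^sub>C x) = c * g x) \<and>
     (\<exists>K. \<forall>x. cmod (g x) \<le> K * norm x)"

lemma cfunctionalI:
  assumes "\<And>x y. g (x + y) = g x + g y" "\<And>c x. g (c *\<^sub>C x) = c * g x"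
    and "\<And>x. cmod (g x) \<le> K * norm x"
  shows "cfunctional g"
  using assms unfolding cfunctional_def by blast

lemma cfunctional_add: "cfunctional g \<Longrightarrow> g (x + y) = g x + g y"
  and cfunctional_scaleC: "cfunctional g \<Longrightarrow> g (c *\<^sub>C x) = c * g x"
  and cfunctional_bounded: "cfunctional g \<Longrightarrow> \<exists>K. \<forall>x. cmod (g x) \<le> K * norm x"
  by (simp_all add: cfunctional_def)

lemma cfunctional_zero: "cfunctional g \<Longrightarrow> g 0 = 0"
  using cfunctional_scaleC[of g 0 0] by simp

lemma cfunctional_diff: "cfunctional g \<Longrightarrow> g (x - y) = g x - g y"
  using cfunctional_add[of g "x - y" y] by simp

lemmas cfunctional_simps =
  cfunctional_add cfunctional_scaleC cfunctional_zero cfunctional_diff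

lemma cfunctional_cinner: "cfunctional (\<lambda>w. cinner w y)"
  unfolding cfunctional_def
  by (metis cinner_add_left cinner_scaleC_left cinner_Cauchy_Schwarz mult.commute)

lemma cfunctional_plus:
  assumes "cfunctional f" "cfunctional g" shows "cfunctional (\<lambda>w. f w + g w)"
proof -
  obtain K L where "\<And>x. cmod (f x) \<le> K * norm x" "\<And>x. cmod (g x) \<le> L * norm x"
    using assms cfunctional_bounded by metis
  then have bound: "cmod (f x + g x) \<le> (K + L) * norm x" for x
    by (smt (verit) norm_triangle_ineq distrib_right)
  show ?thesis
    by (rule cfunctionalI[OF _ _ bound])
      (simp_all add: assms cfunctional_add cfunctional_scaleC algebra_simps)
qed

lemma cfunctional_cmult:
  assumes "cfunctional f" shows "cfunctional (\<lambda>w. c * f w)"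
proof -
  obtain K where "\<And>x. cmod (f x) \<le> K * norm x"
    using assms cfunctional_bounded by metis
  then have bound: "cmod (c * f x) \<le> (cmod c * K) * norm x" for x
    by (simp add: norm_mult mult.assoc mult_left_mono)
  show ?thesis
    by (rule cfunctionalI[OF _ _ bound])
      (simp_all add: assms cfunctional_add cfunctional_scaleC algebra_simps)
qed

lemma cfunctional_minus_fun:
  assumes "cfunctional f" "cfunctional g" shows "cfunctional (\<lambda>w. f w - g w)"
  using cfunctional_plus[OF assms(1) cfunctional_cmult[OF assms(2), of "-1"]] by simp

lemma cinner_self_eq_0: "cinner v v = 0 \<Longrightarrow> v = 0"
  by (simp add: cinner_self)

lemma cfunctional_separates:
  assumes "\<And>g. cfunctional g \<Longrightarrow> g v = g w" shows "v = w"
  using assms[OF cfunctional_cinner[of "v - w"]] cinner_self_eq_0[of "v - w"]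
  by (simp add: cinner_diff_left)

lemma obtain_dual_functional:
  assumes "x \<noteq> 0"
  obtains k where "cfunctional k" "k x = 1" "\<And>w. k w = 0 \<Longrightarrow> cinner w x = 0"
proof
  show "cfunctional (\<lambda>w. (1 / cinner x x) * cinner w x)"
    by (rule cfunctional_cmult[OF cfunctional_cinner])
  show "(1 / cinner x x) * cinner x x = 1"
    using assms cinner_self_eq_0 by auto
  show "cinner w x = 0" if "(1 / cinner x x) * cinner w x = 0" for w
    using that assms cinner_self_eq_0 by auto
qed

text \<open>Later arguments normalise \<open>g x = 1\<close>, so tests vanishing at \<open>x\<close>
  must be avoided. Testing with \<open>x\<close> makes \<open>v - w\<close> orthogonal to
  \<open>x\<close>; hence \<open>x + (v - w)\<close> is an admissible test vector, and it forces
  \<open>v - w\<close> to be 0.\<close>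

lemma cfunctional_separates_nonzero:
  assumes "x \<noteq> 0" and g: "\<And>g. cfunctional g \<Longrightarrow> g x \<noteq> 0 \<Longrightarrow> g v = g w"
  shows "v = w"
proof -
  let ?d = "v - w"
  have g': "g ?d = 0" if "cfunctional g" "g x \<noteq> 0" for g
    using g[OF that] that by (simp add: cfunctional_diff)
  have "cinner ?d x = 0"
    using g'[OF cfunctional_cinner[of x]] assms(1) cinner_self_eq_0 by blast
  then have "cinner x ?d = 0"
    by (subst cinner_commute) simp
  then have "cinner x (x + ?d) \<noteq> 0"
    using assms(1) cinner_self_eq_0 by (auto simp: cinner_add_right)
  then have "cinner ?d (x + ?d) = 0"
    by (rule g'[OF cfunctional_cinner])
  then have "cinner ?d ?d = 0"
    using \<open>cinner ?d x = 0\<close> by (simp add: cinner_add_right)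
  then show ?thesis
    using cinner_self_eq_0[of ?d] by simp
qed

subsection \<open>Rank-one and compact operators\<close>

lemma scaleC_blinfun_apply: "blinfun_apply (c *\<^sub>C T) x = c *\<^sub>C blinfun_apply T x"
  by transfer simp

lemma norm_scaleC_blinfun_le: "norm (c *\<^sub>C T) \<le> cmod c * norm T"
  for T :: "'a::real_normed_vector \<Rightarrow>\<^sub>L 'b::complex_inner"
proof (rule norm_blinfun_bound)
  show "norm (blinfun_apply (c *\<^sub>C T) x) \<le> cmod c * norm T * norm x" for x
    using mult_left_mono[OF norm_blinfun[of T x], of "cmod c"]
    by (simp add: scaleC_blinfun_apply norm_scaleC mult.assoc)
qed simp

lemma bounded_bilinear_scaleC_blinfun:
  "bounded_bilinear (\<lambda>c (T :: 'a::real_normed_vector \<Rightarrow>\<^sub>L 'b::complex_inner). c *\<^sub>C T)"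
proof
  fix r :: real and a a' :: complex and b b' :: "'a \<Rightarrow>\<^sub>L 'b"
  show "(r *\<^sub>R a) *\<^sub>C b = r *\<^sub>R a *\<^sub>C b"
    by (simp add: scaleC_of_real[symmetric] scaleC_scaleC scaleR_conv_of_real)
  show "\<exists>K. \<forall>a (b :: 'a \<Rightarrow>\<^sub>L 'b). norm (a *\<^sub>C b) \<le> norm a * norm b * K"
    by (intro exI[of _ 1]) (simp add: norm_scaleC_blinfun_le)
qed (simp_all add: scaleC_add_left scaleC_add_right scaleC_scaleR_commute)

lemma bounded_bilinear_scaleC: "bounded_bilinear (\<lambda>c (x :: 'b::complex_inner). c *\<^sub>C x)"
proof
  fix r :: real and a a' :: complex and b b' :: 'b
  show "(r *\<^sub>R a) *\<^sub>C b = r *\<^sub>R a *\<^sub>C b"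
    by (simp add: scaleC_of_real[symmetric] scaleC_scaleC scaleR_conv_of_real)
  show "\<exists>K. \<forall>a (b :: 'b). norm (a *\<^sub>C b) \<le> norm a * norm b * K"
    by (intro exI[of _ 1]) (simp add: norm_scaleC)
qed (simp_all add: scaleC_add_left scaleC_add_right scaleC_scaleR_commute)

text \<open>The tensor \<open>v \<otimes> f\<close>. \<open>Blinfun\<close> fixes its values only on
  bounded linear maps, hence the assumption \<open>cfunctional f\<close> in the lemmas about
  it.\<close>

definition rank_one :: "('h::complex_inner \<Rightarrow> complex) \<Rightarrow> 'h \<Rightarrow> 'h \<Rightarrow>\<^sub>L 'h" where
  "rank_one f v = Blinfun (\<lambda>w. f w *\<^sub>C v)"

lemma rank_one_apply [simp]:
  assumes "cfunctional f" shows "blinfun_apply (rank_one f v) w = f w *\<^sub>C v"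
proof -
  obtain K where K: "\<And>x. cmod (f x) \<le> K * norm x"
    using assms cfunctional_bounded by metis
  have "f (r *\<^sub>R x) = r *\<^sub>R f x" for r x
    using cfunctional_scaleC[OF assms, of "of_real r" x] 
    by (simp add: scaleC_of_real scaleR_conv_of_real)
  moreover have "norm (f x *\<^sub>C v) \<le> norm x * (K * norm v)" for x
    using mult_right_mono[OF K[of x], of "norm v"] by (simp add: norm_scaleC mult_ac)
  ultimately have "bounded_linear (\<lambda>w. f w *\<^sub>C v)"
    using assms
    by (intro bounded_linear_intro)
       (simp_all add: cfunctional_simps scaleC_add_left scaleC_of_real[symmetric] scaleC_scaleC
          scaleR_conv_of_real)
  then show ?thesis
    by (simp add: rank_one_def bounded_linear_Blinfun_apply)
qed

lemma rank_one_add_right: "cfunctional f \<Longrightarrow> rank_one f (u + v) = rank_one f u + rank_one f v"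
  by (rule blinfun_eqI) (simp add: blinfun.add_left scaleC_add_right)

lemma rank_one_add_left:
  "cfunctional f \<Longrightarrow> cfunctional g \<Longrightarrow> rank_one (\<lambda>w. f w + g w) v = rank_one f v + rank_one g v"
  by (rule blinfun_eqI) (simp add: blinfun.add_left scaleC_add_left cfunctional_plus)

lemma rank_one_scale_left: "cfunctional f \<Longrightarrow> rank_one (\<lambda>w. c * f w) v = c *\<^sub>C rank_one f v"
  by (rule blinfun_eqI) (simp add: scaleC_blinfun_apply scaleC_scaleC cfunctional_cmult)

lemma rank_one_scale_right: "cfunctional f \<Longrightarrow> rank_one f (c *\<^sub>C v) = c *\<^sub>C rank_one f v"
  by (rule blinfun_eqI) (simp add: scaleC_blinfun_apply scaleC_left_commute)

text \<open>Split \<open>f\<close> and \<open>x\<close> along the dual pair \<open>(k, e)\<close>.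
  The mixed terms vanish by \<open>zero\<close>, and the complementary block is compared with
  \<open>b k e\<close> through one more pair whose pairing is 0.\<close>

lemma bilinear_eq_pairing:
  fixes b :: "('h::complex_inner \<Rightarrow> complex) \<Rightarrow> 'h \<Rightarrow> complex"
  assumes add_l: "\<And>f f' x. cfunctional f \<Longrightarrow> cfunctional f' \<Longrightarrow> b (\<lambda>w. f w + f' w) x = b f x + b f' x"
    and scale_l: "\<And>f c x. cfunctional f \<Longrightarrow> b (\<lambda>w. c * f w) x = c * b f x"
    and add_r: "\<And>f x x'. cfunctional f \<Longrightarrow> b f (x + x') = b f x + b f x'"
    and scale_r: "\<And>f c x. cfunctional f \<Longrightarrow> b f (c *\<^sub>C x) = c * b f x"
    and zero: "\<And>f x. cfunctional f \<Longrightarrow> f x = 0 \<Longrightarrow> b f x = 0"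
    and f: "cfunctional f" and k: "cfunctional k" and ke: "k e = 1"
  shows "b f x = f x * b k e"
proof -
  define f0 where "f0 = (\<lambda>w. f w + (- f e) * k w)"
  define x0 where "x0 = x + (- k x) *\<^sub>C e"
  note fs = cfunctional_simps[OF f] and ks = cfunctional_simps[OF k]
  have f0: "cfunctional f0"
    unfolding f0_def by (intro cfunctional_plus cfunctional_cmult f k)
  have f0e: "f0 e = 0" and kx0: "k x0 = 0" and f0x0: "f0 x0 = f x - f e * k x"
    by (simp_all add: f0_def x0_def ke fs ks algebra_simps)
  \<comment> \<open>\<open>f0 + k\<close> annihilates \<open>x0 - f0(x0) e\<close>; expanding this
    single zero ties \<open>b f0 x0\<close> to \<open>b k e\<close>.\<close>
  have "b (\<lambda>w. f0 w + k w) (x0 + (- f0 x0) *\<^sub>C e) = 0"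
    using f0e kx0 ke
    by (intro zero cfunctional_plus f0 k) (simp add: cfunctional_simps[OF f0] ks)
  then have 1: "b f0 x0 = f0 x0 * b k e"
    using zero[OF f0 f0e] zero[OF k kx0] by (simp add: add_l add_r scale_r f0 k)
  have f_eq: "f = (\<lambda>w. f0 w + f e * k w)" and x_eq: "x = x0 + k x *\<^sub>C e"
    by (simp_all add: f0_def x0_def scaleC_minus_left)
  have "b f x = b (\<lambda>w. f0 w + f e * k w) (x0 + k x *\<^sub>C e)"
    using f_eq x_eq by simp
  also have "\<dots> = b f0 x0 + f e * (k x * b k e)"
    using zero[OF f0 f0e] zero[OF k kx0] by (simp add: add_l add_r scale_l scale_r f0 k cfunctional_cmult)
  finally show ?thesis
    unfolding 1 f0x0 by (simp add: algebra_simps)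
qed

section \<open>The algebra of compact operators\<close>

lemma compact_operator_scaleC:
  "compact_operator T \<Longrightarrow> blinfun_apply T (c *\<^sub>C x) = c *\<^sub>C blinfun_apply T x"
  by (simp add: compact_operator_def)

text \<open>A compact superset of the image is easier to exhibit than compactness of the closure,
  which follows because closed subsets of compact sets are compact.\<close>

lemma compact_operatorI:
  assumes "\<And>c x. blinfun_apply T (c *\<^sub>C x) = c *\<^sub>C blinfun_apply T x"
    and "\<And>S. bounded S \<Longrightarrow> \<exists>C. compact C \<and> blinfun_apply T ` S \<subseteq> C"
  shows "compact_operator T"
  unfolding compact_operator_def
proof (intro conjI allI impI assms(1))
  fix S :: "'a set" assume "bounded S"
  then obtain C where C: "compact C" "blinfun_apply T ` S \<subseteq> C"
    using assms(2) by blast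
  then have "closure (blinfun_apply T ` S) \<subseteq> C"
    by (simp add: closure_minimal compact_imp_closed)
  then show "compact (closure (blinfun_apply T ` S))"
    using C by (metis closed_closure compact_Int_closed inf.absorb_iff2)
qed

lemma compact_operatorD:
  "compact_operator T \<Longrightarrow> bounded S \<Longrightarrow> \<exists>C. compact C \<and> blinfun_apply T ` S \<subseteq> C"
  unfolding compact_operator_def by (meson closure_subset)

lemma compact_operator_add:
  assumes "compact_operator A" "compact_operator B" shows "compact_operator (A + B)"
proof (rule compact_operatorI)
  fix S :: "'a set" assume "bounded S"
  then obtain C D where CD: "compact C" "compact D" "blinfun_apply A ` S \<subseteq> C" "blinfun_apply B ` S \<subseteq> D"
    using assms compact_operatorD by metis
  have "blinfun_apply (A + B) ` S \<subseteq> {x + y |x y. x \<in> C \<and> y \<in> D}"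
    using CD by (force simp: blinfun.add_left)
  then show "\<exists>C. compact C \<and> blinfun_apply (A + B) ` S \<subseteq> C"
    using compact_sums[OF CD(1,2)] by (intro exI conjI)
qed (simp add: assms blinfun.add_left compact_operator_scaleC scaleC_add_right)

lemma compact_operator_scale:
  assumes "compact_operator A" shows "compact_operator (c *\<^sub>C A)"
proof (rule compact_operatorI)
  fix S :: "'a set" assume "bounded S"
  then obtain C where C: "compact C" "blinfun_apply A ` S \<subseteq> C"
    using assms compact_operatorD by metis
  have "compact ((\<lambda>x. c *\<^sub>C x) ` C)"
    using C by (intro compact_continuous_image bounded_linear.continuous_on[OF
      bounded_bilinear.bounded_linear_right[OF bounded_bilinear_scaleC]] continuous_on_id)
  moreover have "blinfun_apply (c *\<^sub>C A) ` S \<subseteq> (\<lambda>x. c *\<^sub>C x) ` C"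
    using C by (auto simp: scaleC_blinfun_apply)
  ultimately show "\<exists>C. compact C \<and> blinfun_apply (c *\<^sub>C A) ` S \<subseteq> C"
    by blast
qed (simp add: assms scaleC_blinfun_apply compact_operator_scaleC scaleC_left_commute)

lemma compact_operator_diff:
  assumes "compact_operator A" "compact_operator B" shows "compact_operator (A - B)"
  using compact_operator_add[OF assms(1) compact_operator_scale[OF assms(2), of "-1"]]
  by (simp add: scaleC_minus_left)

lemma compact_operator_compose:
  assumes "compact_operator A" "compact_operator B" shows "compact_operator (A o\<^sub>L B)"
proof (rule compact_operatorI)
  fix S :: "'a set" assume "bounded S"
  then have "bounded (blinfun_apply B ` S)"
    by (rule bounded_linear_image[OF _ blinfun.bounded_linear_right])
  then obtain C where "compact C" "blinfun_apply A ` blinfun_apply B ` S \<subseteq> C"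
    using compact_operatorD[OF assms(1)] by blast
  then show "\<exists>C. compact C \<and> blinfun_apply (A o\<^sub>L B) ` S \<subseteq> C"
    by (intro exI[of _ C]) auto
qed (simp add: assms compact_operator_scaleC)

lemma compact_operator_rank_one:
  assumes "cfunctional f" shows "compact_operator (rank_one f v)"
proof (rule compact_operatorI)
  fix S :: "'a set" assume "bounded S"
  then obtain M where M: "\<And>x. x \<in> S \<Longrightarrow> norm x \<le> M"
    by (auto simp: bounded_iff)
  obtain K where K: "\<And>x. cmod (f x) \<le> K * norm x"
    using assms cfunctional_bounded by metis
  have "cmod (f x) \<le> \<bar>K\<bar> * M" if "x \<in> S" for x
    using K[of x] M[OF that] by (smt (verit) mult_mono norm_ge_zero)
  then have "blinfun_apply (rank_one f v) ` S \<subseteq> (\<lambda>c. c *\<^sub>C v) ` cball 0 (\<bar>K\<bar> * M)"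
    using assms by auto
  moreover have "compact ((\<lambda>c. c *\<^sub>C v) ` cball 0 (\<bar>K\<bar> * M))"
    by (intro compact_continuous_image bounded_linear.continuous_on[OF
      bounded_bilinear.bounded_linear_left[OF bounded_bilinear_scaleC]] continuous_on_id) simp
  ultimately show "\<exists>C. compact C \<and> blinfun_apply (rank_one f v) ` S \<subseteq> C"
    by blast
qed (simp add: assms cfunctional_simps scaleC_scaleC)

lemma cfunctional_compose:
  assumes "cfunctional g" "compact_operator A" shows "cfunctional (\<lambda>w. g (blinfun_apply A w))"
proof -
  obtain K where K: "\<And>x. cmod (g x) \<le> K * norm x"
    using assms cfunctional_bounded by metis
  have "cmod (g (blinfun_apply A w)) \<le> (\<bar>K\<bar> * norm A) * norm w" for w
  proof -
    have "cmod (g (blinfun_apply A w)) \<le> \<bar>K\<bar> * norm (blinfun_apply A w)"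
      by (rule order_trans[OF K]) (simp add: mult_right_mono)
    also have "\<dots> \<le> \<bar>K\<bar> * (norm A * norm w)"
      by (intro mult_left_mono norm_blinfun) simp
    finally show ?thesis by (simp add: mult.assoc)
  qed
  then show ?thesis
    using assms by (intro cfunctionalI)
      (simp_all add: cfunctional_add cfunctional_scaleC compact_operator_scaleC blinfun.add_right)
qed

lemma compact_operator_0: "compact_operator 0"
  by (rule compact_operatorI) (auto intro: exI[of _ "{0}"])

lemmas compact_operator_intros = compact_operator_add compact_operator_diff
  compact_operator_scale compact_operator_rank_one cfunctional_plus cfunctional_minus_fun
  cfunctional_cmult cfunctional_compose

lemmas blinfun_apply_simps = blinfun.add_left blinfun.diff_left blinfun.add_right
  blinfun.diff_right scaleC_blinfun_apply

subsection \<open>The induced map on compact operators\<close>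

text \<open>Models \<open>A \<mapsto> \<Delta>(a)(t)\<close> for the constant function
  \<open>a\<close> with value \<open>A\<close> and a fixed point \<open>t\<close>. In
  \<open>F_eq\<close>, the difference of \<open>A\<close> and \<open>B\<close> has \<open>x\<close>
  as right and \<open>g\<close> as left eigenvector for the same eigenvalue
  \<open>l\<close>.\<close>

locale weak_local_map =
  fixes F :: "('h::complex_hilbert_space \<Rightarrow>\<^sub>L 'h) \<Rightarrow> ('h \<Rightarrow>\<^sub>L 'h)"
  assumes F_clinear: "compact_operator A \<Longrightarrow> blinfun_apply (F A) (c *\<^sub>C x) = c *\<^sub>C blinfun_apply (F A) x"
    and F_scaleC: "compact_operator A \<Longrightarrow> F (c *\<^sub>C A) = c *\<^sub>C F A"
    and F_eq: "\<lbrakk>compact_operator A; compact_operator B; cfunctional g;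
      blinfun_apply A x - blinfun_apply B x = l *\<^sub>C x;
      \<And>w. g (blinfun_apply A w) - g (blinfun_apply B w) = l * g w\<rbrakk>
      \<Longrightarrow> g (blinfun_apply (F A) x) = g (blinfun_apply (F B) x)"
begin

lemma F_0: "F 0 = 0"
  using F_scaleC[OF compact_operator_0, of 0] by simp

text \<open>The case \<open>l = 0\<close>: \<open>A\<close> may be exchanged for any operator with
  the same value at \<open>x\<close> and the same composite with \<open>g\<close>.\<close>

lemma F_cong:
  assumes "compact_operator A" "compact_operator B" "cfunctional g"
    and "blinfun_apply A x = blinfun_apply B x" "\<And>w. g (blinfun_apply A w) = g (blinfun_apply B w)"
  shows "g (blinfun_apply (F A) x) = g (blinfun_apply (F B) x)"
  using assms by (intro F_eq[where l = 0]) simp_all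

lemma F_eigen:
  assumes "compact_operator A" "cfunctional g"
    and "blinfun_apply A x = l *\<^sub>C x" "\<And>w. g (blinfun_apply A w) = l * g w"
  shows "g (blinfun_apply (F A) x) = 0"
  using F_eq[OF assms(1) compact_operator_0 assms(2), of x l] assms
  by (simp add: F_0 cfunctional_zero[OF assms(2)])

section \<open>Additivity of the induced map\<close>

text \<open>In dimension one every operator is a scalar, so \<open>F_eigen\<close> applies. This
  settles the case in which no second vector is available for interpolation.\<close>

lemma F_one_dim:
  assumes "compact_operator A" "cfunctional g" and "\<And>w. \<exists>c. w = c *\<^sub>C x"
  shows "g (blinfun_apply (F A) x) = 0"
proof -
  obtain l where l: "blinfun_apply A x = l *\<^sub>C x"
    using assms(3) by blast
  have "g (blinfun_apply A w) = l * g w" for w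
  proof -
    obtain c where "w = c *\<^sub>C x" using assms(3) by blast
    then show ?thesis
      using assms(1,2) l by (simp add: compact_operator_scaleC cfunctional_scaleC)
  qed
  then show ?thesis
    using F_eigen[OF assms(1,2) l] by blast
qed

text \<open>The operator \<open>S\<close> below agrees with \<open>2A\<close> at \<open>x + \<xi>\<close> and with \<open>2B'\<close> at \<open>x - \<xi>\<close>; since \<open>F S\<close> is
  linear, adding the two values isolates the one at \<open>x\<close>. In \<open>F_add_same_vector\<close> the functionals
  \<open>g + m\<close> and \<open>g - m\<close> play the role of these two vectors.\<close>

lemma F_add_same_functional:
  assumes A: "compact_operator A" and B: "compact_operator B" and g: "cfunctional g" and "x \<noteq> 0"
    and eq: "\<And>w. g (blinfun_apply A w) = g (blinfun_apply B w)"
  shows "g (blinfun_apply (F (A + B)) x) = g (blinfun_apply (F A) x) + g (blinfun_apply (F B) x)"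
proof (cases "\<forall>w. \<exists>c. w = c *\<^sub>C x")
  case True
  then show ?thesis
    by (simp add: F_one_dim A B g compact_operator_add)
next
  case False
  then obtain w0 where w0: "\<And>c. w0 \<noteq> c *\<^sub>C x" by blast
  obtain k where k: "cfunctional k" "k x = 1" "\<And>w. k w = 0 \<Longrightarrow> cinner w x = 0"
    using obtain_dual_functional[OF \<open>x \<noteq> 0\<close>] by metis
  define \<xi> where "\<xi> = w0 - k w0 *\<^sub>C x"
  have "\<xi> \<noteq> 0" "k \<xi> = 0"
    using w0 k by (auto simp: \<xi>_def cfunctional_simps[OF k(1)])
  obtain m0 where m0: "cfunctional m0" "m0 \<xi> = 1"
    using obtain_dual_functional[OF \<open>\<xi> \<noteq> 0\<close>] by metis
  \<comment> \<open>Subtracting a multiple of \<open>k\<close> makes the functional vanish at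
    \<open>x\<close>; its value 1 at \<open>\<xi>\<close> survives because
    \<open>k \<xi> = 0\<close>.\<close>
  define m where "m = (\<lambda>w. m0 w - m0 x * k w)"
  have m: "cfunctional m"
    unfolding m_def by (intro cfunctional_minus_fun cfunctional_cmult m0 k)
  have m\<xi>: "m \<xi> = 1" and mx: "m x = 0"
    using m0 k \<open>k \<xi> = 0\<close> by (simp_all add: m_def)
  note gs = cfunctional_simps[OF g]
  \<comment> \<open>\<open>B'\<close> takes the value of \<open>B\<close> at \<open>x\<close> and of
    \<open>A\<close> at \<open>\<xi>\<close>, and \<open>g\<close> does not see the correction,
    since \<open>g\<close> agrees on \<open>A \<xi>\<close> and \<open>B \<xi>\<close>.\<close>
  define B' where "B' = B + rank_one m (blinfun_apply A \<xi> - blinfun_apply B \<xi>)"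
  define S where "S = A + B' + rank_one m (blinfun_apply A x - blinfun_apply B x)"
  have B': "compact_operator B'" and S: "compact_operator S"
    unfolding B'_def S_def by (intro compact_operator_intros A B m)+
  have gB': "g (blinfun_apply B' w) = g (blinfun_apply B w)" for w
    by (simp add: B'_def blinfun_apply_simps m gs eq)
  have B'x: "blinfun_apply B' x = blinfun_apply B x" and B'\<xi>: "blinfun_apply B' \<xi> = blinfun_apply A \<xi>"
    by (simp_all add: B'_def blinfun_apply_simps m m\<xi> mx)
  have gS: "g (blinfun_apply S w) = 2 * g (blinfun_apply A w)" for w
    by (simp add: S_def blinfun_apply_simps m gs gB' eq)
  have Sx: "blinfun_apply S x = blinfun_apply A x + blinfun_apply B x"
    and S\<xi>: "blinfun_apply S \<xi> = 2 *\<^sub>C blinfun_apply A \<xi> + blinfun_apply A x - blinfun_apply B x"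
    by (simp_all add: S_def blinfun_apply_simps m m\<xi> mx B'x B'\<xi> scaleC_two)
  let ?P = "\<lambda>T y. g (blinfun_apply (F T) y)"
  have "?P S (x + \<xi>) = ?P (2 *\<^sub>C A) (x + \<xi>)"
    by (intro F_cong S A g compact_operator_scale)
      (simp_all add: blinfun_apply_simps Sx S\<xi> scaleC_two gS gs)
  moreover have "?P S (x - \<xi>) = ?P (2 *\<^sub>C B') (x - \<xi>)"
    by (intro F_cong S B' g compact_operator_scale)
      (simp_all add: blinfun_apply_simps Sx S\<xi> scaleC_two B'x B'\<xi> gS gB' gs eq)
  ultimately have "?P S x = ?P A x + ?P B' x + (?P A \<xi> - ?P B' \<xi>)"
    by (simp add: F_scaleC A B' blinfun_apply_simps gs) algebra
  moreover have "?P B' \<xi> = ?P A \<xi>"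
    by (intro F_cong B' A g) (simp_all add: B'\<xi> gB' eq)
  moreover have "?P B' x = ?P B x"
    by (intro F_cong B' B g) (simp_all add: B'x gB')
  moreover have "?P S x = ?P (A + B) x"
    by (intro F_cong S A B g compact_operator_add) (simp_all add: blinfun_apply_simps Sx gS gs eq)
  ultimately show ?thesis by simp
qed

lemma F_add_same_vector:
  assumes A: "compact_operator A" and B: "compact_operator B" and g: "cfunctional g" and "x \<noteq> 0"
    and eq: "blinfun_apply A x = blinfun_apply B x"
  shows "g (blinfun_apply (F (A + B)) x) = g (blinfun_apply (F A) x) + g (blinfun_apply (F B) x)"
proof (cases "\<forall>w. \<exists>c. w = c *\<^sub>C x")
  case True
  then show ?thesis
    by (simp add: F_one_dim A B g compact_operator_add)
next
  case False
  note gs = cfunctional_simps[OF g]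
  from False obtain w0 where w0: "\<And>c. w0 \<noteq> c *\<^sub>C x" by blast
  \<comment> \<open>The kernel of \<open>g\<close> is nontrivial in dimension at least two: it
    contains \<open>x\<close>, or else the projection of \<open>w0\<close> along
    \<open>x\<close>.\<close>
  have "\<exists>\<xi>. \<xi> \<noteq> 0 \<and> g \<xi> = 0"
  proof (cases "g x = 0")
    case True
    then show ?thesis using \<open>x \<noteq> 0\<close> by blast
  next
    case False
    then show ?thesis
      using w0[of "g w0 / g x"] by (intro exI[of _ "w0 - (g w0 / g x) *\<^sub>C x"]) (simp add: gs)
  qed
  then obtain \<xi> where \<xi>: "\<xi> \<noteq> 0" "g \<xi> = 0" by blast
  obtain m where m: "cfunctional m" and m\<xi>: "m \<xi> = 1"
    using obtain_dual_functional[OF \<open>\<xi> \<noteq> 0\<close>] by metis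
  note ms = cfunctional_simps[OF m]
  let ?dm = "\<lambda>w. m (blinfun_apply A w) - m (blinfun_apply B w)"
  let ?dg = "\<lambda>w. g (blinfun_apply A w) - g (blinfun_apply B w)"
  have d: "cfunctional ?dm" "cfunctional ?dg"
    by (intro compact_operator_intros A B m g)+
  \<comment> \<open>The transposed construction: corrections in the direction \<open>\<xi>\<close>
    are invisible to \<open>g\<close>, so \<open>m\<close> composed with \<open>B'\<close> can be
    adjusted to that of \<open>A\<close>. At \<open>x\<close> both corrections vanish by
    \<open>eq\<close>.\<close>
  define B' where "B' = B + rank_one ?dm \<xi>"
  define S where "S = A + B' + rank_one ?dg \<xi>"
  have B': "compact_operator B'" and S: "compact_operator S"
    unfolding B'_def S_def by (intro compact_operator_intros A B m g)+
  have B'x: "blinfun_apply B' x = blinfun_apply A x"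
    by (simp add: B'_def blinfun_apply_simps d eq)
  have gB': "g (blinfun_apply B' w) = g (blinfun_apply B w)"
    and mB': "m (blinfun_apply B' w) = m (blinfun_apply A w)" for w
    by (simp_all add: B'_def blinfun_apply_simps d gs ms \<xi> m\<xi>)
  have Sx: "blinfun_apply S x = 2 *\<^sub>C blinfun_apply A x"
    by (simp add: S_def blinfun_apply_simps d eq B'x scaleC_two)
  have gS: "g (blinfun_apply S w) = g (blinfun_apply A w) + g (blinfun_apply B w)"
    and mS: "m (blinfun_apply S w) = 2 * m (blinfun_apply A w) + g (blinfun_apply A w) - g (blinfun_apply B w)" for w
    by (simp_all add: S_def blinfun_apply_simps d gs ms \<xi> m\<xi> gB' mB')
  let ?P = "\<lambda>h T. h (blinfun_apply (F T) x)"
  have "?P (\<lambda>w. g w + m w) S = ?P (\<lambda>w. g w + m w) (2 *\<^sub>C A)"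
    by (intro F_cong S A compact_operator_scale cfunctional_plus g m)
      (simp_all add: scaleC_blinfun_apply Sx gS mS gs ms)
  moreover have "?P (\<lambda>w. g w - m w) S = ?P (\<lambda>w. g w - m w) (2 *\<^sub>C B')"
    by (intro F_cong S B' compact_operator_scale cfunctional_minus_fun g m)
      (simp_all add: scaleC_blinfun_apply Sx B'x gS mS gB' mB' gs ms)
  ultimately have "?P g S = ?P g A + ?P g B' + (?P m A - ?P m B')"
    by (simp add: F_scaleC A B' scaleC_blinfun_apply gs ms) algebra
  moreover have "?P m B' = ?P m A"
    by (intro F_cong B' A m) (simp_all add: B'x mB')
  moreover have "?P g B' = ?P g B"
    by (intro F_cong B' B g) (simp_all add: B'x eq gB')
  moreover have "?P g S = ?P g (A + B)"
    by (intro F_cong S A B g compact_operator_add)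
      (simp_all add: blinfun_apply_simps Sx scaleC_two gS gs eq)
  ultimately show ?thesis by simp
qed

text \<open>\<open>U\<close> carries the value at \<open>x\<close> and \<open>V\<close> the
  composite with \<open>g\<close>; by \<open>zero\<close> their sum has the same data as
  \<open>A\<close>. The two partial additivity lemmas link \<open>U + V\<close> to
  \<open>U/2 + V\<close>, and homogeneity solves the resulting linear equations.\<close>

lemma F_split:
  assumes A: "compact_operator A" and g: "cfunctional g" and k: "cfunctional k" and "k x = 1" "g v = 1"
    and zero: "g (blinfun_apply A x) = 0"
  shows "g (blinfun_apply (F A) x) = g (blinfun_apply (F (rank_one k (blinfun_apply A x))) x)
    + g (blinfun_apply (F (rank_one (\<lambda>w. g (blinfun_apply A w)) v)) x)"
proof -
  have "x \<noteq> 0"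
    using \<open>k x = 1\<close> cfunctional_zero[OF k] by auto
  note gs = cfunctional_simps[OF g]
  let ?P = "\<lambda>T. g (blinfun_apply (F T) x)"
  have gA: "cfunctional (\<lambda>w. g (blinfun_apply A w))"
    by (rule cfunctional_compose[OF g A])
  define U where "U = rank_one k (blinfun_apply A x)"
  define V where "V = rank_one (\<lambda>w. g (blinfun_apply A w)) v"
  define U2 where "U2 = (1/2) *\<^sub>C U"
  have U: "compact_operator U" and V: "compact_operator V" and U2: "compact_operator U2"
    unfolding U_def V_def U2_def by (intro compact_operator_intros k g A)+
  have Ux: "blinfun_apply U x = blinfun_apply A x" and gU: "g (blinfun_apply U w) = 0"
    and Vx: "blinfun_apply V x = 0" and gV: "g (blinfun_apply V w) = g (blinfun_apply A w)" for w
    using assms by (simp_all add: U_def V_def gA gs)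
  have U2U: "2 *\<^sub>C U2 = U" "U2 + U2 = U"
    by (simp_all add: U2_def scaleC_scaleC scaleC_two[symmetric])
  have "?P A = ?P (U + V)"
    by (intro F_cong A U V g compact_operator_add) (simp_all add: blinfun_apply_simps Ux Vx gU gV gs)
  moreover have "U + V = (U2 + V) + U2"
    by (simp add: U2U(2)[symmetric])
  \<comment> \<open>\<open>U2 + V\<close> and \<open>U2\<close> agree at \<open>x\<close> because
    \<open>V x = 0\<close>.\<close>
  moreover have "?P ((U2 + V) + U2) = ?P (U2 + V) + ?P U2"
    by (rule F_add_same_vector[OF compact_operator_add[OF U2 V] U2 g \<open>x \<noteq> 0\<close>])
      (simp add: blinfun_apply_simps Vx)
  \<comment> \<open>\<open>U + V\<close> and \<open>V\<close> have equal composites with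
    \<open>g\<close>, and their sum is twice \<open>U2 + V\<close>.\<close>
  moreover have "?P ((U + V) + V) = ?P (U + V) + ?P V"
    by (rule F_add_same_functional[OF compact_operator_add[OF U V] V g \<open>x \<noteq> 0\<close>])
      (simp add: blinfun_apply_simps gU gs)
  moreover have "(U + V) + V = 2 *\<^sub>C (U2 + V)"
    by (simp add: scaleC_add_right U2U scaleC_two)
  then have "?P ((U + V) + V) = 2 * ?P (U2 + V)"
    by (simp add: F_scaleC U2 V compact_operator_add scaleC_blinfun_apply gs)
  moreover have "?P U = 2 * ?P U2"
    using F_scaleC[OF U2, of 2] U2U by (simp add: scaleC_blinfun_apply gs)
  ultimately have "?P A = ?P U + ?P V"
    by (simp add: algebra_simps)
  then show ?thesis
    unfolding U_def V_def .
qed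

text \<open>For \<open>g x = 1\<close> the idempotent \<open>rank_one g x\<close> fixes
  \<open>x\<close> and \<open>g\<close>. Taking \<open>c = g (A x)\<close> arranges the hypothesis
  \<open>zero\<close> of \<open>F_split\<close>.\<close>

lemma F_shift:
  assumes A: "compact_operator A" and g: "cfunctional g" and "g x = 1"
  shows "g (blinfun_apply (F A) x) = g (blinfun_apply (F (A - c *\<^sub>C rank_one g x)) x)"
  using assms
  by (intro F_eq[where l = c] compact_operator_intros)
    (simp_all add: blinfun_apply_simps cfunctional_simps[OF g])

lemma F_add:
  assumes A: "compact_operator A" and B: "compact_operator B"
  shows "F (A + B) = F A + F B"
proof (rule blinfun_eqI)
  fix x
  show "blinfun_apply (F (A + B)) x = blinfun_apply (F A + F B) x"
  proof (cases "x = 0")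
    case True
    then show ?thesis by (simp add: blinfun.zero_right)
  next
    case False
    have main: "g (blinfun_apply (F (A + B)) x) = g (blinfun_apply (F A) x) + g (blinfun_apply (F B) x)"
      if g: "cfunctional g" and gx: "g x = 1" for g
    proof -
      note gs = cfunctional_simps[OF g]
      let ?P = "\<lambda>T. g (blinfun_apply (F T) x)"
      define A' where "A' = A - g (blinfun_apply A x) *\<^sub>C rank_one g x"
      define B' where "B' = B - g (blinfun_apply B x) *\<^sub>C rank_one g x"
      have A': "compact_operator A'" and B': "compact_operator B'"
        unfolding A'_def B'_def by (intro compact_operator_intros A B g)+
      have zero: "g (blinfun_apply A' x) = 0" "g (blinfun_apply B' x) = 0"
        by (simp_all add: A'_def B'_def blinfun_apply_simps g gx gs)
      have AB': "A' + B' = (A + B) - (g (blinfun_apply A x) + g (blinfun_apply B x)) *\<^sub>C rank_one g x"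
        by (simp add: A'_def B'_def scaleC_add_left)
      have PA: "?P A = ?P A'" and PB: "?P B = ?P B'" and PAB: "?P (A + B) = ?P (A' + B')"
        unfolding AB' unfolding A'_def B'_def
        by (intro F_shift A B g gx compact_operator_add)+
      note split = F_split[OF _ g g gx gx]
      \<comment> \<open>Both parts depend additively on \<open>T\<close>. After the shift the
        \<open>?U\<close> terms are killed by \<open>g\<close> and the \<open>?V\<close> terms
        vanish at \<open>x\<close>, so each sum falls under one partial additivity lemma.\<close>
      let ?U = "\<lambda>T. rank_one g (blinfun_apply T x)"
      let ?V = "\<lambda>T. rank_one (\<lambda>w. g (blinfun_apply T w)) x"
      have U: "?U (A' + B') = ?U A' + ?U B'"
        by (simp add: blinfun.add_left rank_one_add_right g)
      have V: "?V (A' + B') = ?V A' + ?V B'"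
        using rank_one_add_left[OF cfunctional_compose[OF g A'] cfunctional_compose[OF g B']]
        by (simp add: blinfun.add_left gs)
      have "?P (?U A' + ?U B') = ?P (?U A') + ?P (?U B')"
        using zero by (intro F_add_same_functional compact_operator_rank_one g False) (simp add: g gs)
      moreover have "?P (?V A' + ?V B') = ?P (?V A') + ?P (?V B')"
        using zero
        by (intro F_add_same_vector compact_operator_rank_one cfunctional_compose g A' B' False)
          (simp add: cfunctional_compose g A' B')
      ultimately show ?thesis
        unfolding PA PB PAB
        using split[OF A' zero(1)] split[OF B' zero(2)]
          split[OF compact_operator_add[OF A' B'], unfolded U V] zero
        by (simp add: blinfun.add_left gs)
    qed
    show ?thesis
    proof (rule cfunctional_separates_nonzero[OF False])
      fix g assume g: "cfunctional g" "g x \<noteq> 0"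
      then show "g (blinfun_apply (F (A + B)) x) = g (blinfun_apply (F A + F B) x)"
        using main[OF cfunctional_cmult[OF g(1), of "1 / g x"]]
        by (simp add: blinfun.add_left cfunctional_add field_simps)
    qed
  qed
qed

lemma F_diff: "compact_operator A \<Longrightarrow> compact_operator B \<Longrightarrow> F (A - B) = F A - F B"
  using F_add[of "A - B" B] by (simp add: compact_operator_diff)

section \<open>Values on rank-one operators and the commutator form\<close>

lemma F_rank_one_zero:
  assumes "cfunctional g" "cfunctional f" "g u = 0" "f x = 0"
  shows "g (blinfun_apply (F (rank_one f u)) x) = 0"
  using assms by (intro F_eigen[where l = 0] compact_operator_rank_one) (simp_all add: cfunctional_scaleC)

text \<open>With \<open>g u = 0\<close> fixed, the expression is bilinear in \<open>(f, x)\<close>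
  and vanishes for \<open>f x = 0\<close>. The next lemma exchanges the roles of the two
  pairs.\<close>

lemma F_rank_one_annihilating:
  assumes g: "cfunctional g" and "g u = 0" and f: "cfunctional f" and k: "cfunctional k" "k e = 1"
  shows "g (blinfun_apply (F (rank_one f u)) x) = f x * g (blinfun_apply (F (rank_one k u)) e)"
proof (rule bilinear_eq_pairing[where b = "\<lambda>f x. g (blinfun_apply (F (rank_one f u)) x)"])
  fix f f' :: "'h \<Rightarrow> complex" and x x' :: 'h and c :: complex
  note gs = cfunctional_simps[OF g]
  assume f: "cfunctional f"
  note co = compact_operator_rank_one[OF f]
  show "g (blinfun_apply (F (rank_one (\<lambda>w. c * f w) u)) x) = c * g (blinfun_apply (F (rank_one f u)) x)"
    by (simp add: rank_one_scale_left f F_scaleC co scaleC_blinfun_apply gs)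
  show "g (blinfun_apply (F (rank_one f u)) (x + x')) =
      g (blinfun_apply (F (rank_one f u)) x) + g (blinfun_apply (F (rank_one f u)) x')"
    by (simp add: blinfun.add_right gs)
  show "g (blinfun_apply (F (rank_one f u)) (c *\<^sub>C x)) = c * g (blinfun_apply (F (rank_one f u)) x)"
    by (simp add: F_clinear co gs)
  show "g (blinfun_apply (F (rank_one f u)) x) = 0" if "f x = 0"
    using F_rank_one_zero[OF g f \<open>g u = 0\<close> that] .
  show "g (blinfun_apply (F (rank_one (\<lambda>w. f w + f' w) u)) x) =
      g (blinfun_apply (F (rank_one f u)) x) + g (blinfun_apply (F (rank_one f' u)) x)"
    if "cfunctional f'"
    using that
    by (simp add: rank_one_add_left f F_add compact_operator_rank_one blinfun.add_left gs)
qed (fact f k)+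

lemma F_rank_one_annihilated:
  assumes g: "cfunctional g" and f: "cfunctional f" and "f x = 0" and k: "cfunctional k" "k e = 1"
  shows "g (blinfun_apply (F (rank_one f u)) x) = g u * k (blinfun_apply (F (rank_one f e)) x)"
proof (rule bilinear_eq_pairing[where b = "\<lambda>g u. g (blinfun_apply (F (rank_one f u)) x)"])
  fix g :: "'h \<Rightarrow> complex" and u u' :: 'h and c :: complex
  assume g: "cfunctional g"
  note gs = cfunctional_simps[OF g]
  note co = compact_operator_rank_one[OF f]
  show "g (blinfun_apply (F (rank_one f (u + u'))) x) =
      g (blinfun_apply (F (rank_one f u)) x) + g (blinfun_apply (F (rank_one f u')) x)"
    by (simp add: rank_one_add_right f F_add co blinfun.add_left gs)
  show "g (blinfun_apply (F (rank_one f (c *\<^sub>C u))) x) = c * g (blinfun_apply (F (rank_one f u)) x)"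
    by (simp add: rank_one_scale_right f F_scaleC co scaleC_blinfun_apply gs)
  show "g (blinfun_apply (F (rank_one f u)) x) = 0" if "g u = 0"
    using F_rank_one_zero[OF g f that \<open>f x = 0\<close>] .
qed (simp_all add: g k)

text \<open>Polarisation of \<open>F_eigen\<close>: \<open>k\<close>, \<open>f\<close> and
  \<open>k + f\<close> each give an operator with an eigenvalue at \<open>x\<close>, so only the two
  cross terms remain and they cancel.\<close>

lemma F_rank_one_dual:
  assumes f: "cfunctional f" and k: "cfunctional k" and "f x = 0" "k x = 1"
  shows "k (blinfun_apply (F (rank_one f x)) x) = - f (blinfun_apply (F (rank_one k x)) x)"
proof -
  note fs = cfunctional_simps[OF f] and ks = cfunctional_simps[OF k]
  have "(\<lambda>w. k w + f w) (blinfun_apply (F (rank_one (\<lambda>w. k w + f w) x)) x) = 0"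
    using assms
    by (intro F_eigen[where l = 1] compact_operator_rank_one cfunctional_plus)
      (simp_all add: cfunctional_plus fs ks)
  moreover have "k (blinfun_apply (F (rank_one k x)) x) = 0"
    using assms by (intro F_eigen[where l = 1] compact_operator_rank_one) (simp_all add: ks)
  moreover have "f (blinfun_apply (F (rank_one f x)) x) = 0"
    by (rule F_rank_one_zero[OF f f]) fact+
  ultimately show ?thesis
    by (simp add: rank_one_add_left f k F_add compact_operator_rank_one blinfun.add_left fs ks
        eq_neg_iff_add_eq_0 add.commute)
qed

text \<open>If \<open>F = [z, _]\<close>, then \<open>Z\<close> differs from \<open>z\<close> by a scalar. No bound on \<open>Z\<close> is needed.\<close>

lemma F_commutator:
  assumes A: "compact_operator A" and k: "cfunctional k" and ke: "k e = 1"
  defines "Z \<equiv> \<lambda>x. blinfun_apply (F (rank_one k x)) e"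
  shows "blinfun_apply (F A) x = Z (blinfun_apply A x) - blinfun_apply A (Z x)"
proof (cases "x = 0")
  case True
  have "rank_one k 0 = 0"
    by (rule blinfun_eqI) (simp add: k)
  then show ?thesis
    using True by (simp add: Z_def F_0 blinfun.zero_right)
next
  case False
  note co = compact_operator_rank_one[OF k]
  have Z_diff: "Z (u - c *\<^sub>C v) = Z u - c *\<^sub>C Z v" for u v c
  proof -
    have "rank_one k (u - c *\<^sub>C v) = rank_one k u - c *\<^sub>C rank_one k v"
      by (rule blinfun_eqI) (simp add: k blinfun_apply_simps scaleC_diff_right scaleC_left_commute)
    then show ?thesis
      by (simp add: Z_def F_diff F_scaleC co compact_operator_scale blinfun_apply_simps)
  qed
  have dual: "g (blinfun_apply (F (rank_one f u)) x) = - (g u * f (Z x))"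
    if g: "cfunctional g" and f: "cfunctional f" and "f x = 0" for g f u
  proof -
    \<comment> \<open>The pair \<open>(h, x)\<close> is an intermediary: move the value onto it,
      exchange \<open>h\<close> and \<open>f\<close> with a sign change, then move on to
      \<open>(k, e)\<close> to reach \<open>Z x\<close>.\<close>
    obtain h where h: "cfunctional h" "h x = 1"
      using obtain_dual_functional[OF False] by metis
    have "f (blinfun_apply (F (rank_one h x)) x) = f (Z x)"
      using F_rank_one_annihilating[OF f \<open>f x = 0\<close> h(1) k ke, of x] h by (simp add: Z_def)
    then show ?thesis
      using F_rank_one_annihilated[OF g f \<open>f x = 0\<close> h, of u] F_rank_one_dual[OF f h(1) \<open>f x = 0\<close> h(2)]
      by simp
  qed
  have main: "g (blinfun_apply (F A) x) = g (Z (blinfun_apply A x) - blinfun_apply A (Z x))"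
    if g: "cfunctional g" and gx: "g x = 1" for g
  proof -
    note gs = cfunctional_simps[OF g]
    define A' where "A' = A - g (blinfun_apply A x) *\<^sub>C rank_one g x"
    have A': "compact_operator A'"
      unfolding A'_def by (intro compact_operator_intros A g)
    have zero: "g (blinfun_apply A' x) = 0"
      by (simp add: A'_def blinfun_apply_simps g gx gs)
    have "g (blinfun_apply (F A) x) = g (blinfun_apply (F A') x)"
      unfolding A'_def by (rule F_shift[OF A g gx])
    \<comment> \<open>The first summand of \<open>F_split\<close> yields the \<open>Z (A' x)\<close>
      term, the second the other term by \<open>dual\<close>.\<close>
    also have "\<dots> = g (Z (blinfun_apply A' x)) - g (blinfun_apply A' (Z x))"
      using F_split[OF A' g g gx gx zero]
        F_rank_one_annihilating[OF g zero g k ke, of x]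
        dual[OF g cfunctional_compose[OF g A'] zero, of x]
      by (simp add: gx Z_def)
    \<comment> \<open>Undoing the shift adds the same multiple of \<open>g (Z x)\<close> to both
      terms, because \<open>g x = 1\<close>.\<close>
    also have "\<dots> = g (Z (blinfun_apply A x) - blinfun_apply A (Z x))"
      by (simp add: A'_def blinfun_apply_simps g gx gs Z_diff)
    finally show ?thesis .
  qed
  show ?thesis
  proof (rule cfunctional_separates_nonzero[OF False])
    fix g assume g: "cfunctional g" "g x \<noteq> 0"
    then show "g (blinfun_apply (F A) x) = g (Z (blinfun_apply A x) - blinfun_apply A (Z x))"
      using main[OF cfunctional_cmult[OF g(1), of "1 / g x"]] by (simp add: field_simps)
  qed
qed

text \<open>The Leibniz rule of a commutator: the terms \<open>A (Z (B x))\<close> cancel.\<close>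

lemma F_compose:
  assumes A: "compact_operator A" and B: "compact_operator B"
  shows "F (A o\<^sub>L B) = (F A o\<^sub>L B) + (A o\<^sub>L F B)"
proof (rule blinfun_eqI)
  fix x
  show "blinfun_apply (F (A o\<^sub>L B)) x = blinfun_apply ((F A o\<^sub>L B) + (A o\<^sub>L F B)) x"
  proof (cases "x = 0")
    case True
    then show ?thesis by (simp add: blinfun.zero_right)
  next
    case False
    then obtain k where k: "cfunctional k" "k x = 1"
      using obtain_dual_functional by metis
    show ?thesis
      by (simp add: F_commutator[OF _ k] A B compact_operator_compose blinfun_apply_simps)
  qed
qed

end

subsection \<open>Derivations of \<open>C(\<Omega>, K(H))\<close>\<close>

lemma continuous_map_bounded_bilinear:
  assumes "bounded_bilinear b" "continuous_map X euclidean f" "continuous_map X euclidean g"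
  shows "continuous_map X euclidean (\<lambda>s. b (f s) (g s))"
  using assms(2,3) by (simp add: continuous_map_atin bounded_bilinear.tendsto[OF assms(1)])

lemma C_KI:
  assumes "continuous_map X euclidean f" "\<And>t. t \<in> topspace X \<Longrightarrow> compact_operator (f t)"
    and "\<And>t. t \<notin> topspace X \<Longrightarrow> f t = 0"
  shows "f \<in> C_K X"
  using assms by (simp add: C_K_def)

lemma C_K_D:
  assumes "f \<in> C_K X"
  shows "continuous_map X euclidean f" "compact_operator (f t)" "t \<notin> topspace X \<Longrightarrow> f t = 0"
  using assms compact_operator_0 by (auto simp: C_K_def)

lemma C_K_add: "a \<in> C_K X \<Longrightarrow> b \<in> C_K X \<Longrightarrow> (\<lambda>t. a t + b t) \<in> C_K X"
  by (intro C_KI continuous_map_add compact_operator_add) (simp_all add: C_K_D)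

lemma C_K_compose: "a \<in> C_K X \<Longrightarrow> b \<in> C_K X \<Longrightarrow> (\<lambda>t. a t o\<^sub>L b t) \<in> C_K X"
  by (intro C_KI continuous_map_bounded_bilinear[OF bounded_bilinear_blinfun_compose] compact_operator_compose)
    (simp_all add: C_K_D)

lemma C_K_scale: "a \<in> C_K X \<Longrightarrow> (\<lambda>t. c *\<^sub>C a t) \<in> C_K X"
  by (intro C_KI continuous_map_bounded_bilinear[OF bounded_bilinear_scaleC_blinfun] compact_operator_scale)
    (simp_all add: C_K_D)

lemma C_K_diff: "a \<in> C_K X \<Longrightarrow> b \<in> C_K X \<Longrightarrow> (\<lambda>t. a t - b t) \<in> C_K X"
  using C_K_add[OF _ C_K_scale[of b X "-1"], of a] by (simp add: scaleC_minus_left)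

text \<open>The tensor \<open>h \<otimes> A\<close>; the cut-off matches the extension by 0 used in
  \<open>C_K\<close>.\<close>

definition elementary :: "'a topology \<Rightarrow> ('a \<Rightarrow> complex) \<Rightarrow> ('h::complex_hilbert_space \<Rightarrow>\<^sub>L 'h) \<Rightarrow> 'a \<Rightarrow> ('h \<Rightarrow>\<^sub>L 'h)"
  where "elementary X h A = (\<lambda>s. if s \<in> topspace X then h s *\<^sub>C A else 0)"

lemma elementary_in_C_K:
  assumes "continuous_map X euclidean h" "compact_operator A"
  shows "elementary X h A \<in> C_K X"
proof (rule C_KI)
  have "continuous_map X euclidean (\<lambda>s. h s *\<^sub>C A)"
    by (intro continuous_map_bounded_bilinear[OF bounded_bilinear_scaleC_blinfun] assms(1)) simp
  then show "continuous_map X euclidean (elementary X h A)"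
    by (rule continuous_map_eq) (simp add: elementary_def)
qed (simp_all add: elementary_def compact_operator_scale assms)

lemma elementary_apply: "s \<in> topspace X \<Longrightarrow> elementary X h A s = h s *\<^sub>C A"
  by (simp add: elementary_def)

text \<open>Together with \<open>sqrt (cmod z)\<close> this factors \<open>z\<close> into two
  continuous functions vanishing at 0. At 0, where \<open>sgn\<close> jumps, the modulus is squeezed
  by \<open>sqrt (cmod z)\<close>.\<close>

lemma continuous_sgn_sqrt: "continuous_on UNIV (\<lambda>z::complex. sgn z * of_real (sqrt (cmod z)))"
proof -
  have "isCont (\<lambda>z::complex. sgn z * of_real (sqrt (cmod z))) z" for z
  proof (cases "z = 0")
    case True
    have "((\<lambda>z::complex. sqrt (cmod z)) \<longlongrightarrow> sqrt (cmod 0)) (at 0)"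
      by (intro tendsto_intros)
    then have "((\<lambda>z::complex. sqrt (cmod z)) \<longlongrightarrow> 0) (at 0)"
      by simp
    then have "((\<lambda>z::complex. sgn z * of_real (sqrt (cmod z))) \<longlongrightarrow> 0) (at 0)"
      by (rule Lim_null_comparison[where g = "\<lambda>z. sqrt (cmod z)", rotated])
        (simp_all add: norm_mult norm_sgn)
    then show ?thesis using True by (simp add: isCont_def)
  next
    case False
    then show ?thesis by (intro continuous_intros) simp_all
  qed
  then show ?thesis by (simp add: continuous_on_eq_continuous_at)
qed

lemma
  assumes D: "derivation X D" and a: "a \<in> C_K X"
  shows derivation_in_C_K: "D a \<in> C_K X"
    and derivation_scale: "D (\<lambda>t. c *\<^sub>C a t) = (\<lambda>t. c *\<^sub>C D a t)"
    and derivation_add: "b \<in> C_K X \<Longrightarrow> D (\<lambda>t. a t + b t) = (\<lambda>t. D a t + D b t)"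
    and derivation_compose: "b \<in> C_K X \<Longrightarrow>
      D (\<lambda>t. a t o\<^sub>L b t) = (\<lambda>t. (D a t o\<^sub>L b t) + (a t o\<^sub>L D b t))"
  using assms by (auto simp: derivation_def)

text \<open>The function \<open>q c p - l q p\<close>, for idempotents \<open>p\<close> fixing \<open>x\<close> and \<open>q\<close> fixing \<open>g\<close>, is a scalar function
  \<open>h\<close> times a constant operator, and \<open>h t = 0\<close>. Writing \<open>h\<close> as a product of two continuous functions
  vanishing at \<open>t\<close> shows that its image under \<open>D\<close> vanishes at \<open>t\<close>.\<close>

lemma derivation_eigen:
  assumes D: "derivation X D" and t: "t \<in> topspace X" and c: "c \<in> C_K X" and g: "cfunctional g"
    and cx: "blinfun_apply (c t) x = l *\<^sub>C x" and gc: "\<And>w. g (blinfun_apply (c t) w) = l * g w"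
  shows "g (blinfun_apply (D c t) x) = 0"
proof (cases "x = 0 \<or> (\<forall>w. g w = 0)")
  case True
  then show ?thesis using cfunctional_zero[OF g] by auto
next
  case False
  note gs = cfunctional_simps[OF g]
  from False obtain w where "g w \<noteq> 0" by blast
  then obtain v where v: "g v = 1"
    using that[of "(1 / g w) *\<^sub>C w"] by (simp add: gs)
  from False obtain k where k: "cfunctional k" and kx: "k x = 1"
    using obtain_dual_functional by metis
  note co = compact_operator_rank_one[OF k] compact_operator_rank_one[OF g]
  note D_add = derivation_add[OF D] and D_scale = derivation_scale[OF D]
    and D_mult = derivation_compose[OF D]
  define P where "P = elementary X (\<lambda>_. 1) (rank_one k x)"
  define Q where "Q = elementary X (\<lambda>_. 1) (rank_one g v)"
  have P: "P \<in> C_K X" and Q: "Q \<in> C_K X"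
    unfolding P_def Q_def by (intro elementary_in_C_K co; simp)+
  have Pt: "P s = rank_one k x" and Qt: "Q s = rank_one g v" if "s \<in> topspace X" for s
    using that by (simp_all add: P_def Q_def elementary_apply)
  \<comment> \<open>The scalar coefficient of \<open>Q c P - l Q P\<close> with respect to the
    constant operator \<open>rank_one k v\<close>.\<close>
  define h where "h = (\<lambda>s. g (blinfun_apply (c s) x) - l * g x)"
  have ht: "h t = 0"
    by (simp add: h_def gc)
  obtain K where K: "\<And>y. cmod (g y) \<le> K * norm y"
    using cfunctional_bounded[OF g] by metis
  have "g (r *\<^sub>R y) = r *\<^sub>R g y" for r y
    using cfunctional_scaleC[OF g, of "of_real r" y] by (simp add: scaleC_of_real scaleR_conv_of_real)
  then have "bounded_linear g"
    using K by (intro bounded_linear_intro[where K = K]) (simp_all add: gs mult.commute)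
  then have "bounded_linear (\<lambda>T. g (blinfun_apply T x))"
    by (rule bounded_linear_compose[OF _ blinfun.bounded_linear_left])
  then have "continuous_map euclidean euclidean (\<lambda>T. g (blinfun_apply T x) - l * g x)"
    by (auto intro!: continuous_intros simp: linear_continuous_on)
  then have h: "continuous_map X euclidean h"
    using continuous_map_compose[OF C_K_D(1)[OF c]] unfolding h_def o_def by blast
  have "continuous_map euclidean euclidean (\<lambda>z::complex. complex_of_real (sqrt (cmod z)))"
    by (auto intro!: continuous_intros)
  from continuous_map_compose[OF h this]
  have root: "continuous_map X euclidean (\<lambda>s. complex_of_real (sqrt (cmod (h s))))"
    by (simp add: o_def)
  have "continuous_map euclidean euclidean (\<lambda>z::complex. sgn z * complex_of_real (sqrt (cmod z)))"
    using continuous_sgn_sqrt by simp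
  from continuous_map_compose[OF h this]
  have sgn_root: "continuous_map X euclidean (\<lambda>s. sgn (h s) * complex_of_real (sqrt (cmod (h s))))"
    by (simp add: o_def)
  define U where "U = elementary X (\<lambda>s. complex_of_real (sqrt (cmod (h s)))) (rank_one g v)"
  define W where "W = elementary X (\<lambda>s. sgn (h s) * complex_of_real (sqrt (cmod (h s)))) (rank_one k v)"
  have U: "U \<in> C_K X" and W: "W \<in> C_K X"
    unfolding U_def W_def by (intro elementary_in_C_K co root sgn_root)+
  have Ut: "U t = 0" and Wt: "W t = 0"
    using t by (simp_all add: U_def W_def elementary_apply ht)
  have root_mult: "complex_of_real (sqrt (cmod z)) * (sgn z * complex_of_real (sqrt (cmod z))) = z" for z
  proof -
    have "complex_of_real (sqrt (cmod z)) * (sgn z * complex_of_real (sqrt (cmod z)))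
      = sgn z * complex_of_real (sqrt (cmod z) * sqrt (cmod z))"
      by (simp only: of_real_mult mult_ac)
    also have "\<dots> = z"
      by (simp add: sgn_eq del: of_real_mult)
    finally show ?thesis .
  qed
  have "(Q s o\<^sub>L c s) o\<^sub>L P s = (U s o\<^sub>L W s) + l *\<^sub>C (Q s o\<^sub>L P s)" for s
  proof (cases "s \<in> topspace X")
    case True
    have "(U s o\<^sub>L W s) = h s *\<^sub>C rank_one k v"
      using True root_mult[of "h s"]
      by (intro blinfun_eqI)
        (simp add: U_def W_def elementary_apply scaleC_blinfun_apply g k gs v scaleC_scaleC mult_ac)
    then show ?thesis
      using True
      by (intro blinfun_eqI)
        (simp add: Pt Qt blinfun_apply_simps g k gs scaleC_scaleC h_def compact_operator_scaleC C_K_D(2)[OF c]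
          scaleC_add_left[symmetric] algebra_simps)
  next
    case False
    then show ?thesis by (simp add: C_K_D(3)[OF P] C_K_D(3)[OF U] C_K_D(3)[OF Q])
  qed
  then have "D (\<lambda>s. (Q s o\<^sub>L c s) o\<^sub>L P s) = D (\<lambda>s. (U s o\<^sub>L W s) + l *\<^sub>C (Q s o\<^sub>L P s))"
    by simp
  also have "\<dots> = (\<lambda>s. D (\<lambda>s. U s o\<^sub>L W s) s + l *\<^sub>C D (\<lambda>s. Q s o\<^sub>L P s) s)"
    using P Q U W by (simp add: D_add D_scale C_K_compose C_K_scale)
  finally have "D (\<lambda>s. (Q s o\<^sub>L c s) o\<^sub>L P s) t = D (\<lambda>s. U s o\<^sub>L W s) t + l *\<^sub>C D (\<lambda>s. Q s o\<^sub>L P s) t"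
    by simp
  \<comment> \<open>The product rule for \<open>U\<close> and \<open>W\<close> leaves nothing at
    \<open>t\<close>, since both factors are 0 there.\<close>
  then have "(((D Q t o\<^sub>L c t) + (Q t o\<^sub>L D c t)) o\<^sub>L P t) + ((Q t o\<^sub>L c t) o\<^sub>L D P t)
      = l *\<^sub>C ((D Q t o\<^sub>L P t) + (Q t o\<^sub>L D P t))"
    using P Q U W c by (simp add: D_mult C_K_compose Ut Wt)
  then have "g (blinfun_apply ((((D Q t o\<^sub>L c t) + (Q t o\<^sub>L D c t)) o\<^sub>L P t) + ((Q t o\<^sub>L c t) o\<^sub>L D P t)) x)
      = g (blinfun_apply (l *\<^sub>C ((D Q t o\<^sub>L P t) + (Q t o\<^sub>L D P t))) x)"
    by simp
  moreover have "compact_operator (D Q t)"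
    using C_K_D(2)[OF derivation_in_C_K[OF D Q]] .
  \<comment> \<open>As \<open>g Q = g\<close> and \<open>P x = x\<close>, the eigenvalue relations
    cancel the terms with \<open>D Q\<close> and \<open>D P\<close>, leaving
    \<open>g (D c t x) = 0\<close>.\<close>
  ultimately show ?thesis
    using t by (simp add: Pt Qt blinfun_apply_simps g k kx gs v cx gc compact_operator_scaleC algebra_simps)
qed

section \<open>Testing weak-2-local derivations on point functionals\<close>

lemma norm_le_sup_norm:
  assumes "compact_space X" "a \<in> C_K X" shows "norm (a t) \<le> sup_norm a"
proof -
  have "compactin euclidean (a ` topspace X)"
    using assms by (intro image_compactin C_K_D(1)) (simp_all add: compact_space_def)
  then have "bounded (a ` topspace X)"
    by (simp add: compactin_euclidean_iff compact_imp_bounded)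
  then obtain M where M: "\<And>s. s \<in> topspace X \<Longrightarrow> norm (a s) \<le> M"
    by (auto simp: bounded_iff)
  \<comment> \<open>The maximum with 0 covers the points outside \<open>topspace X\<close>.\<close>
  have "norm (a s) \<le> max M 0" for s
    using M[of s] C_K_D(3)[OF assms(2), of s] by (cases "s \<in> topspace X") auto
  then have "bdd_above (range (\<lambda>s. norm (a s)))"
    by (intro bdd_aboveI) blast
  then show ?thesis
    unfolding sup_norm_def by (rule cSUP_upper[rotated]) simp
qed

lemma evaluation_in_dual:
  assumes "compact_space X" and g: "cfunctional g"
  shows "(\<lambda>a. g (blinfun_apply (a t) x)) \<in> dual_C_K X"
proof -
  obtain K where K: "\<And>y. cmod (g y) \<le> K * norm y"
    using cfunctional_bounded[OF g] by metis
  have "cmod (g (blinfun_apply (a t) x)) \<le> (\<bar>K\<bar> * norm x) * sup_norm a" if "a \<in> C_K X" for a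
  proof -
    have "cmod (g (blinfun_apply (a t) x)) \<le> \<bar>K\<bar> * norm (blinfun_apply (a t) x)"
      by (rule order_trans[OF K]) (simp add: mult_right_mono)
    also have "\<dots> \<le> \<bar>K\<bar> * (norm (a t) * norm x)"
      by (intro mult_left_mono norm_blinfun) simp
    also have "\<dots> \<le> \<bar>K\<bar> * (sup_norm a * norm x)"
      by (intro mult_left_mono mult_right_mono norm_le_sup_norm[OF assms(1) that]) simp_all
    finally show ?thesis by (simp add: mult_ac)
  qed
  then show ?thesis
    unfolding dual_C_K_def by (auto simp: blinfun_apply_simps cfunctional_simps[OF g])
qed

lemma weak_2_local_derivationE:
  assumes "weak_2_local_derivation X \<Delta>" "a \<in> C_K X" "b \<in> C_K X" "\<phi> \<in> dual_C_K X"
  obtains D where "derivation X D" "\<phi> (\<Delta> a) = \<phi> (D a)" "\<phi> (\<Delta> b) = \<phi> (D b)"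
proof -
  from assms(1) have "\<forall>a\<in>C_K X. \<forall>b\<in>C_K X. \<forall>\<phi>\<in>dual_C_K X.
      \<exists>D. derivation X D \<and> \<phi> (\<Delta> a) = \<phi> (D a) \<and> \<phi> (\<Delta> b) = \<phi> (D b)"
    by (simp add: weak_2_local_derivation_def)
  from this[THEN bspec, OF assms(2), THEN bspec, OF assms(3), THEN bspec, OF assms(4)]
  show thesis using that by (elim exE conjE)
qed

text \<open>The 2-local hypothesis supplies one derivation \<open>D\<close> for both
  \<open>a\<close> and \<open>b\<close>, so the values differ by that of \<open>D (a - b)\<close>,
  which \<open>derivation_eigen\<close> annihilates.\<close>

lemma weak_2_local_derivation_eq:
  assumes X: "compact_space X" and \<Delta>: "weak_2_local_derivation X \<Delta>" and t: "t \<in> topspace X"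
    and a: "a \<in> C_K X" and b: "b \<in> C_K X" and g: "cfunctional g"
    and x: "blinfun_apply (a t) x - blinfun_apply (b t) x = l *\<^sub>C x"
    and dual: "\<And>w. g (blinfun_apply (a t) w) - g (blinfun_apply (b t) w) = l * g w"
  shows "g (blinfun_apply (\<Delta> a t) x) = g (blinfun_apply (\<Delta> b t) x)"
proof -
  from weak_2_local_derivationE[OF \<Delta> a b evaluation_in_dual[OF X g, of t x]]
  obtain D where D: "derivation X D"
    and Da: "g (blinfun_apply (\<Delta> a t) x) = g (blinfun_apply (D a t) x)"
    and Db: "g (blinfun_apply (\<Delta> b t) x) = g (blinfun_apply (D b t) x)"
    by metis
  let ?c = "\<lambda>t. a t - b t"
  have c: "?c \<in> C_K X"
    by (rule C_K_diff[OF a b])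
  have "D (\<lambda>t. ?c t + b t) = (\<lambda>t. D ?c t + D b t)"
    by (rule derivation_add[OF D c b])
  then have "D a t = D ?c t + D b t"
    by simp
  moreover have "g (blinfun_apply (D ?c t) x) = 0"
    by (rule derivation_eigen[OF D t c g, where l = l])
      (simp_all add: blinfun.diff_left x dual cfunctional_diff[OF g])
  ultimately show ?thesis
    by (simp add: Da Db blinfun.add_left cfunctional_add[OF g])
qed

text \<open>Apply the hypothesis to \<open>a\<close> and its multiple: the common derivation is
  homogeneous, and point functionals separate.\<close>

lemma weak_2_local_derivation_scale:
  assumes X: "compact_space X" and \<Delta>: "weak_2_local_derivation X \<Delta>" and a: "a \<in> C_K X"
  shows "\<Delta> (\<lambda>t. c *\<^sub>C a t) = (\<lambda>t. c *\<^sub>C \<Delta> a t)"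
proof (rule ext, rule blinfun_eqI, rule cfunctional_separates)
  fix t x and g :: "'b \<Rightarrow> complex" assume g: "cfunctional g"
  from weak_2_local_derivationE[OF \<Delta> a C_K_scale[OF a, of c] evaluation_in_dual[OF X g, of t x]]
  obtain D where "derivation X D"
    and "g (blinfun_apply (\<Delta> a t) x) = g (blinfun_apply (D a t) x)"
    and "g (blinfun_apply (\<Delta> (\<lambda>t. c *\<^sub>C a t) t) x) = g (blinfun_apply (D (\<lambda>t. c *\<^sub>C a t) t) x)"
    by metis
  then show "g (blinfun_apply (\<Delta> (\<lambda>t. c *\<^sub>C a t) t) x) = g (blinfun_apply (c *\<^sub>C \<Delta> a t) x)"
    using a by (simp add: derivation_scale scaleC_blinfun_apply cfunctional_scaleC[OF g])
qed

theorem theorem2p12: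
  fixes \<Omega> :: "'a topology"
    and \<Delta> :: "('a \<Rightarrow> 'h::complex_hilbert_space \<Rightarrow>\<^sub>L 'h) \<Rightarrow> ('a \<Rightarrow> 'h \<Rightarrow>\<^sub>L 'h)"
  assumes "compact_space \<Omega>" and "Hausdorff_space \<Omega>"
    and "weak_2_local_derivation \<Omega> \<Delta>"
  shows "derivation \<Omega> \<Delta>"
proof -
  note X = assms(1) and \<Delta> = assms(3)
  have maps: "\<Delta> a \<in> C_K \<Omega>" if "a \<in> C_K \<Omega>" for a
    using \<Delta> that unfolding weak_2_local_derivation_def by blast
  define con where "con = (\<lambda>A :: 'h \<Rightarrow>\<^sub>L 'h. elementary \<Omega> (\<lambda>_. 1) A)"
  have con: "con A \<in> C_K \<Omega>" if "compact_operator A" for A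
    unfolding con_def using that by (simp add: elementary_in_C_K)
  have con_apply: "con A s = A" if "s \<in> topspace \<Omega>" for A s
    using that by (simp add: con_def elementary_apply)
  define F where "F = (\<lambda>t A. \<Delta> (con A) t)"
  have weak: "weak_local_map (F t)" if t: "t \<in> topspace \<Omega>" for t
  proof
    fix A B :: "'h \<Rightarrow>\<^sub>L 'h" and c l :: complex and x and g :: "'h \<Rightarrow> complex"
    assume A: "compact_operator A"
    show "blinfun_apply (F t A) (c *\<^sub>C x) = c *\<^sub>C blinfun_apply (F t A) x"
      unfolding F_def by (rule compact_operator_scaleC[OF C_K_D(2)[OF maps[OF con[OF A]]]])
    have "con (c *\<^sub>C A) = (\<lambda>s. c *\<^sub>C con A s)"
      by (rule ext) (simp add: con_def elementary_def)
    then show "F t (c *\<^sub>C A) = c *\<^sub>C F t A"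
      unfolding F_def using weak_2_local_derivation_scale[OF X \<Delta> con[OF A], of c] by simp
    show "g (blinfun_apply (F t A) x) = g (blinfun_apply (F t B) x)"
      if "compact_operator B" "cfunctional g" "blinfun_apply A x - blinfun_apply B x = l *\<^sub>C x"
        "\<And>w. g (blinfun_apply A w) - g (blinfun_apply B w) = l * g w"
      unfolding F_def using that
      by (intro weak_2_local_derivation_eq[OF X \<Delta> t, where l = l] con A) (simp_all add: con_apply t)
  qed
  \<comment> \<open>\<open>a\<close> and the constant function with value \<open>a t\<close>
    coincide at \<open>t\<close>, so the comparison applies with \<open>l = 0\<close>.\<close>
  have local: "\<Delta> a t = F t (a t)" if "a \<in> C_K \<Omega>" "t \<in> topspace \<Omega>" for a t
  proof (rule blinfun_eqI, rule cfunctional_separates)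
    fix x and g :: "'h \<Rightarrow> complex" assume "cfunctional g"
    then show "g (blinfun_apply (\<Delta> a t) x) = g (blinfun_apply (F t (a t)) x)"
      unfolding F_def using that
      by (intro weak_2_local_derivation_eq[OF X \<Delta> that(2), where l = 0] con C_K_D(2)[OF that(1)])
        (simp_all add: con_apply)
  qed
  have outside: "\<Delta> a t = 0" if "a \<in> C_K \<Omega>" "t \<notin> topspace \<Omega>" for a t
    using C_K_D(3)[OF maps] that by blast
  have add: "\<Delta> (\<lambda>t. a t + b t) = (\<lambda>t. \<Delta> a t + \<Delta> b t)" if "a \<in> C_K \<Omega>" "b \<in> C_K \<Omega>" for a b
  proof
    fix t
    show "\<Delta> (\<lambda>t. a t + b t) t = \<Delta> a t + \<Delta> b t"
      using that weak_local_map.F_add[OF weak C_K_D(2)[OF that(1)] C_K_D(2)[OF that(2)]]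
      by (cases "t \<in> topspace \<Omega>") (simp_all add: local outside C_K_add)
  qed
  have mult: "\<Delta> (\<lambda>t. a t o\<^sub>L b t) = (\<lambda>t. (\<Delta> a t o\<^sub>L b t) + (a t o\<^sub>L \<Delta> b t))"
    if "a \<in> C_K \<Omega>" "b \<in> C_K \<Omega>" for a b
  proof
    fix t
    show "\<Delta> (\<lambda>t. a t o\<^sub>L b t) t = (\<Delta> a t o\<^sub>L b t) + (a t o\<^sub>L \<Delta> b t)"
      using that weak_local_map.F_compose[OF weak C_K_D(2)[OF that(1)] C_K_D(2)[OF that(2)]]
      by (cases "t \<in> topspace \<Omega>") (simp_all add: local outside C_K_compose C_K_D(3)[OF that(1)] C_K_D(3)[OF that(2)])
  qed
  show ?thesis
    unfolding derivation_def
    by (intro conjI ballI allI Pi_I maps add mult weak_2_local_derivation_scale[OF X \<Delta>])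
qed

end
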